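(* For every integer $k \ge 3$ and every integer $n \ge 1$: (1) $c_{n,k} = \alpha(Part_{n,k})$; and (2) $\chi(Part_{n,k})$ is equal to the minimal number of colors needed to color $[k]^n$ so that there is no monochromatic combinatorial line.
   Context: $[m]=\{1,\dots,m\}$. Words: elements of $[k]^n$. A combinatorial line in $[k]^n$ is a set of $k$ distinct words that can be placed as the rows of a $k\times n$ table such that every column of the table belongs to $\{(x,x,\ldots,x): x\in[k]\}\cup\{(1,2,\ldots,k)\}$. The density Hales–Jewett number $c_{n,k}$ is the maximal cardinality of a subset of $[k]^n$ containing no combinatorial line. Number-on-the-forehead setting: for a function $f: X_1\times\cdots\times X_k\to\{0,1\}$, a set $C\subseteq X_1\times\cdots\times X_k$ is a cylinder in the $i$-th coordinate if membership of a tuple in $C$ does not depend on its $i$-th coordinate; a cylinder intersection is a set $C=\bigcap_{i=1}^k C_i$ with $C_i$ a cylinder in the $i$-th coordinate. $\alpha(f)$ is the largest size of a cylinder intersection contained in $f^{-1}(1)$, and $\chi(f)$ is the least number of cylinder intersections, each contained in $f^{-1}(1)$, that form a partition of $f^{-1}(1)$. $Part_{n,k}:(2^{[n]})^k\to\{0,1\}$ is defined by $Part_{n,k}(S_1,\ldots,S_k)=1$ iff $(S_1,\ldots,S_k)$ is a partition of $[n]$ (i.e. the $S_i$ are pairwise disjoint with union $[n]$; empty parts allowed). *)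

theory Defs
  imports "HOL-Library.FuncSet" "HOL-Library.Disjoint_Sets"
begin

definition words :: "nat \<Rightarrow> nat \<Rightarrow> (nat \<Rightarrow> nat) set" where
  "words n k = {1..n} \<rightarrow>\<^sub>E {1..k}"

text \<open>The set \<open>L\<close> consists of the rows \<open>T 1, \<dots>, T k\<close> of a \<open>k \<times> n\<close> table. Since the rows are
  distinct, at least one column is \<open>(1, \<dots>, k)\<close> when \<open>k \<ge> 2\<close>.\<close>

definition combinatorial_line :: "nat \<Rightarrow> nat \<Rightarrow> (nat \<Rightarrow> nat) set \<Rightarrow> bool" where
  "combinatorial_line n k L \<longleftrightarrow>
     (\<exists>T :: nat \<Rightarrow> nat \<Rightarrow> nat.
        T \<in> {1..k} \<rightarrow> words n k \<and> inj_on T {1..k} \<and> L = T ` {1..k} \<and>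
        (\<forall>j\<in>{1..n}. (\<exists>x\<in>{1..k}. \<forall>i\<in>{1..k}. T i j = x) \<or> (\<forall>i\<in>{1..k}. T i j = i)))"

definition density_hales_jewett :: "nat \<Rightarrow> nat \<Rightarrow> nat" where
  "density_hales_jewett n k =
     Max {card A | A. A \<subseteq> words n k \<and> \<not> (\<exists>L. combinatorial_line n k L \<and> L \<subseteq> A)}"

definition line_coloring_number :: "nat \<Rightarrow> nat \<Rightarrow> nat" where
  "line_coloring_number n k =
     (LEAST m. \<exists>c :: (nat \<Rightarrow> nat) \<Rightarrow> nat. c \<in> words n k \<rightarrow> {1..m} \<and>
        \<not> (\<exists>L. combinatorial_line n k L \<and> (\<exists>a. \<forall>w\<in>L. c w = a)))"

text \<open>The domain \<open>X\<^sub>1 \<times> \<dots> \<times> X\<^sub>k\<close> is \<open>\<Pi>\<^sub>E i\<in>{1..k}. X i\<close>; outside it the value of \<open>f\<close> is irrelevant.\<close>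

definition cylinder :: "nat \<Rightarrow> (nat \<Rightarrow> 'a set) \<Rightarrow> nat \<Rightarrow> (nat \<Rightarrow> 'a) set \<Rightarrow> bool" where
  "cylinder k X i C \<longleftrightarrow> C \<subseteq> (\<Pi>\<^sub>E j\<in>{1..k}. X j) \<and>
     (\<forall>x\<in>(\<Pi>\<^sub>E j\<in>{1..k}. X j). \<forall>y\<in>X i. x(i := y) \<in> C \<longleftrightarrow> x \<in> C)"

definition cylinder_intersection :: "nat \<Rightarrow> (nat \<Rightarrow> 'a set) \<Rightarrow> (nat \<Rightarrow> 'a) set \<Rightarrow> bool" where
  "cylinder_intersection k X C \<longleftrightarrow>
     (\<exists>D. (\<forall>i\<in>{1..k}. cylinder k X i (D i)) \<and> C = (\<Inter>i\<in>{1..k}. D i))"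

definition ones :: "nat \<Rightarrow> (nat \<Rightarrow> 'a set) \<Rightarrow> ((nat \<Rightarrow> 'a) \<Rightarrow> nat) \<Rightarrow> (nat \<Rightarrow> 'a) set" where
  "ones k X f = {x \<in> (\<Pi>\<^sub>E i\<in>{1..k}. X i). f x = 1}"

definition nof_alpha :: "nat \<Rightarrow> (nat \<Rightarrow> 'a set) \<Rightarrow> ((nat \<Rightarrow> 'a) \<Rightarrow> nat) \<Rightarrow> nat" where
  "nof_alpha k X f = Max {card C | C. cylinder_intersection k X C \<and> C \<subseteq> ones k X f}"

definition nof_chi :: "nat \<Rightarrow> (nat \<Rightarrow> 'a set) \<Rightarrow> ((nat \<Rightarrow> 'a) \<Rightarrow> nat) \<Rightarrow> nat" where
  "nof_chi k X f =
     (LEAST m. \<exists>P. partition_on (ones k X f) P \<and> finite P \<and> card P = m \<and>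
        (\<forall>C\<in>P. cylinder_intersection k X C))"

definition Part :: "nat \<Rightarrow> nat \<Rightarrow> (nat \<Rightarrow> nat set) \<Rightarrow> nat" where
  "Part n k S =
     (if disjoint_family_on S {1..k} \<and> (\<Union>i\<in>{1..k}. S i) = {1..n} then 1 else 0)"

end

(* A word w corresponds to the partition of [n] into its level sets. A set C is a cylinder
   intersection iff it contains the centre x of every star, i.e. of every family of points
   x(1 := y 1), ..., x(k := y k) of C. For k >= 3, the members of a star in Part^{-1}(1) are
   x(i := x i \<union> U) with the same U for all i; either U is empty and the star is a single
   point, or the star is the image of a combinatorial line, with U as its set of active
   coordinates, and its centre is not a partition. So cylinder intersections in Part^{-1}(1)
   correspond exactly to line-free sets of words. *)

theory Submission
  imports Defs
begin

section \<open>Cylinder intersections as star-closed sets\<close>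

text \<open>If the members of a star lie in every \<open>D i\<close>, then so does its centre
  \<open>x\<close>: the i-th member differs from \<open>x\<close> only in coordinate i, which
  \<open>D i\<close> ignores. Conversely, a star-closed set is the intersection of the least
  cylinders around it.\<close>

lemma cylinder_intersection_iff_star_closed:
  assumes "k \<ge> 1"
  shows "cylinder_intersection k X C \<longleftrightarrow>
    C \<subseteq> (\<Pi>\<^sub>E j\<in>{1..k}. X j) \<and>
    (\<forall>x\<in>(\<Pi>\<^sub>E j\<in>{1..k}. X j). (\<forall>i\<in>{1..k}. \<exists>y\<in>X i. x(i := y) \<in> C) \<longrightarrow> x \<in> C)"
    (is "_ \<longleftrightarrow> ?R")
proof
  assume "cylinder_intersection k X C"
  then obtain D where D: "\<And>i. i \<in> {1..k} \<Longrightarrow> cylinder k X i (D i)" "C = (\<Inter>i\<in>{1..k}. D i)"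
    unfolding cylinder_intersection_def by blast
  have "C \<subseteq> D 1" using D(2) assms by auto
  also have "D 1 \<subseteq> (\<Pi>\<^sub>E j\<in>{1..k}. X j)" using D(1)[of 1] assms by (simp add: cylinder_def)
  finally have "C \<subseteq> (\<Pi>\<^sub>E j\<in>{1..k}. X j)" .
  moreover have "x \<in> C" if x: "x \<in> (\<Pi>\<^sub>E j\<in>{1..k}. X j)"
    and star: "\<forall>i\<in>{1..k}. \<exists>y\<in>X i. x(i := y) \<in> C" for x
  proof -
    have "x \<in> D i" if i: "i \<in> {1..k}" for i
    proof -
      obtain y where "y \<in> X i" "x(i := y) \<in> D i" using star i D(2) by blast
      with D(1)[OF i] x show ?thesis unfolding cylinder_def by blast
    qed
    then show ?thesis using D(2) by blast
  qed
  ultimately show ?R by blast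
next
  assume R: ?R
  \<comment> \<open>The least cylinder in coordinate i that contains \<open>C\<close>. A point of
    all the \<open>D i\<close> is then by definition the centre of a star in
    \<open>C\<close>.\<close>
  define D where "D i = {x \<in> (\<Pi>\<^sub>E j\<in>{1..k}. X j). \<exists>y\<in>X i. x(i := y) \<in> C}" for i
  have upd: "x(i := y) \<in> (\<Pi>\<^sub>E j\<in>{1..k}. X j)"
    if "i \<in> {1..k}" "y \<in> X i" "x \<in> (\<Pi>\<^sub>E j\<in>{1..k}. X j)" for i x y
    using that by (auto simp: PiE_iff extensional_def)
  have "cylinder k X i (D i)" if "i \<in> {1..k}" for i
    using upd[OF that] by (auto simp: cylinder_def D_def)
  moreover have "C = (\<Inter>i\<in>{1..k}. D i)"
  proof
    show "C \<subseteq> (\<Inter>i\<in>{1..k}. D i)"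
    proof (intro subsetI INT_I)
      fix x i assume xC: "x \<in> C" and i: "i \<in> {1..k}"
      have x: "x \<in> (\<Pi>\<^sub>E j\<in>{1..k}. X j)" using R xC by blast
      then have "x i \<in> X i" using i by (rule PiE_mem)
      moreover have "x(i := x i) \<in> C" using xC by simp
      ultimately show "x \<in> D i" unfolding D_def using x by blast
    qed
    show "(\<Inter>i\<in>{1..k}. D i) \<subseteq> C"
    proof
      fix x assume x: "x \<in> (\<Inter>i\<in>{1..k}. D i)"
      then have "x \<in> D 1" using assms by simp
      then have "x \<in> (\<Pi>\<^sub>E j\<in>{1..k}. X j)" unfolding D_def by blast
      moreover have "\<forall>i\<in>{1..k}. \<exists>y\<in>X i. x(i := y) \<in> C" using x unfolding D_def by blast
      ultimately show "x \<in> C" using R by blast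
    qed
  qed
  ultimately show "cylinder_intersection k X C" unfolding cylinder_intersection_def by blast
qed

section \<open>Words as ordered partitions\<close>

text \<open>The restriction to \<open>{1..k}\<close> makes the tuple extensional, hence a point of
  the product on which \<open>Part\<close> is considered.\<close>

definition level_sets :: "nat \<Rightarrow> nat \<Rightarrow> (nat \<Rightarrow> nat) \<Rightarrow> nat \<Rightarrow> nat set" where
  "level_sets n k w = (\<lambda>i\<in>{1..k}. {j \<in> {1..n}. w j = i})"

lemma mem_level_sets:
  "i \<in> {1..k} \<Longrightarrow> j \<in> level_sets n k w i \<longleftrightarrow> j \<in> {1..n} \<and> w j = i"
  by (simp add: level_sets_def)

lemma level_sets_in_PiE: "level_sets n k w \<in> {1..k} \<rightarrow>\<^sub>E Pow {1..n}"
  by (auto simp: level_sets_def)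

text \<open>Disjointness is uniqueness of the part containing a coordinate, and covering is its
  existence; this coordinatewise form is what allows a word to be read off from a partition.\<close>

lemma mem_ones_Part_iff:
  "S \<in> ones k (\<lambda>_. Pow {1..n}) (Part n k) \<longleftrightarrow>
     S \<in> {1..k} \<rightarrow>\<^sub>E Pow {1..n} \<and> (\<forall>j\<in>{1..n}. \<exists>!i. i \<in> {1..k} \<and> j \<in> S i)"
proof (cases "S \<in> {1..k} \<rightarrow>\<^sub>E Pow {1..n}")
  case True
  then have sub: "j \<in> {1..n}" if "i \<in> {1..k}" "j \<in> S i" for i j
    using that by (meson PiE_mem PowD subsetD)
  have "disjoint_family_on S {1..k} \<and> (\<Union>i\<in>{1..k}. S i) = {1..n} \<longleftrightarrow>
      (\<forall>j\<in>{1..n}. \<exists>!i. i \<in> {1..k} \<and> j \<in> S i)" (is "?P \<longleftrightarrow> ?Q")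
  proof
    assume P: ?P
    show ?Q
    proof
      fix j assume "j \<in> {1..n}"
      then have "j \<in> (\<Union>i\<in>{1..k}. S i)" using P by simp
      then obtain i where i: "i \<in> {1..k}" "j \<in> S i" by blast
      moreover have "i' = i" if "i' \<in> {1..k}" "j \<in> S i'" for i'
        using P i that unfolding disjoint_family_on_def by blast
      ultimately show "\<exists>!i. i \<in> {1..k} \<and> j \<in> S i" by blast
    qed
  next
    assume Q: ?Q
    have "disjoint_family_on S {1..k}"
      unfolding disjoint_family_on_def using Q sub by blast
    moreover have "(\<Union>i\<in>{1..k}. S i) = {1..n}"
    proof
      show "(\<Union>i\<in>{1..k}. S i) \<subseteq> {1..n}" by (intro UN_least subsetI sub)
      show "{1..n} \<subseteq> (\<Union>i\<in>{1..k}. S i)"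
      proof
        fix j assume "j \<in> {1..n}"
        then obtain i where "i \<in> {1..k}" "j \<in> S i" using Q by metis
        then show "j \<in> (\<Union>i\<in>{1..k}. S i)" by (rule UN_I)
      qed
    qed
    ultimately show ?P by blast
  qed
  with True show ?thesis by (auto simp: ones_def Part_def)
qed (simp add: ones_def)

lemma wordsD: "w \<in> words n k \<Longrightarrow> j \<in> {1..n} \<Longrightarrow> w j \<in> {1..k}"
  by (auto simp: words_def PiE_iff)

lemma finite_words: "finite (words n k)"
  by (simp add: words_def finite_PiE)

lemma bij_betw_level_sets:
  "bij_betw (level_sets n k) (words n k) (ones k (\<lambda>_. Pow {1..n}) (Part n k))"
proof (rule bij_betwI')
  fix v w assume v: "v \<in> words n k" and w: "w \<in> words n k"
  show "level_sets n k v = level_sets n k w \<longleftrightarrow> v = w"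
  proof
    assume eq: "level_sets n k v = level_sets n k w"
    \<comment> \<open>Both tuples are compared at the part with index \<open>v j\<close>, which
      contains \<open>j\<close> on the left and so on the right.\<close>
    have "v j = w j" if j: "j \<in> {1..n}" for j
      using mem_level_sets[OF wordsD[OF v j], of j n v]
        mem_level_sets[OF wordsD[OF v j], of j n w] eq j by simp
    then show "v = w" using PiE_ext[OF v[unfolded words_def] w[unfolded words_def]] by blast
  qed simp
next
  fix w assume "w \<in> words n k"
  then show "level_sets n k w \<in> ones k (\<lambda>_. Pow {1..n}) (Part n k)"
    unfolding mem_ones_Part_iff
    using level_sets_in_PiE mem_level_sets wordsD by (metis (no_types, lifting))
next
  fix S assume S: "S \<in> ones k (\<lambda>_. Pow {1..n}) (Part n k)"
  then have SP: "S \<in> {1..k} \<rightarrow>\<^sub>E Pow {1..n}"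
    and ex1: "\<And>j. j \<in> {1..n} \<Longrightarrow> \<exists>!i. i \<in> {1..k} \<and> j \<in> S i"
    unfolding mem_ones_Part_iff by blast+
  \<comment> \<open>The inverse map: \<open>j\<close> is sent to the index of its part.\<close>
  define w where "w = (\<lambda>j\<in>{1..n}. THE i. i \<in> {1..k} \<and> j \<in> S i)"
  have w: "w j \<in> {1..k} \<and> j \<in> S (w j)" if "j \<in> {1..n}" for j
    using theI'[OF ex1[OF that]] that by (simp add: w_def)
  have "w \<in> words n k" using w by (auto simp: words_def w_def)
  moreover have "S = level_sets n k w"
  proof (rule PiE_ext[OF SP level_sets_in_PiE])
    fix i assume i: "i \<in> {1..k}"
    have "S i \<subseteq> {1..n}" using PiE_mem[OF SP i] by blast
    then show "S i = level_sets n k w i"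
      using w ex1 i mem_level_sets[OF i] by (intro set_eqI) (metis subsetD)
  qed
  ultimately show "\<exists>w\<in>words n k. S = level_sets n k w" by blast
qed

section \<open>Line-free sets and cylinder intersections\<close>

definition line_free :: "nat \<Rightarrow> nat \<Rightarrow> (nat \<Rightarrow> nat) set \<Rightarrow> bool" where
  "line_free n k A \<longleftrightarrow> \<not> (\<exists>L. combinatorial_line n k L \<and> L \<subseteq> A)"

lemma combinatorial_lineE:
  assumes "combinatorial_line n k L"
  obtains T where "T \<in> {1..k} \<rightarrow> words n k" "inj_on T {1..k}" "L = T ` {1..k}"
    "\<And>j. j \<in> {1..n} \<Longrightarrow>
      (\<exists>a\<in>{1..k}. \<forall>i\<in>{1..k}. T i j = a) \<or> (\<forall>i\<in>{1..k}. T i j = i)"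
  using assms unfolding combinatorial_line_def by auto

text \<open>The words \<open>T i\<close> of a star with centre \<open>x\<close> are read as the rows
  of a table. Column \<open>j\<close> is constantly \<open>l\<close> if \<open>j\<close> lies in
  \<open>x l\<close>, and is (1, ..., k) if \<open>j\<close> lies in no part. A column of the second
  kind would give a line in \<open>A\<close>; without one, all rows are the same word and
  \<open>x\<close> is its tuple of level sets.\<close>

lemma line_free_imp_cylinder_intersection:
  assumes k: "k \<ge> 3" and A: "A \<subseteq> words n k" and free: "line_free n k A"
  shows "cylinder_intersection k (\<lambda>_. Pow {1..n}) (level_sets n k ` A)"
proof -
  have "x \<in> level_sets n k ` A" if x: "x \<in> {1..k} \<rightarrow>\<^sub>E Pow {1..n}"
    and star: "\<forall>i\<in>{1..k}. \<exists>y\<in>Pow {1..n}. x(i := y) \<in> level_sets n k ` A" for x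
  proof -
    have "\<forall>i\<in>{1..k}. \<exists>w. w \<in> A \<and> (\<exists>y. x(i := y) = level_sets n k w)" using star by blast
    then obtain T where TA: "\<And>i. i \<in> {1..k} \<Longrightarrow> T i \<in> A"
      and T: "\<And>i. i \<in> {1..k} \<Longrightarrow> \<exists>y. x(i := y) = level_sets n k (T i)"
      by metis
    \<comment> \<open>The i-th member of the star agrees with \<open>x\<close> in every coordinate
      \<open>l\<close> other than i.\<close>
    have row: "T i j = l \<longleftrightarrow> j \<in> x l"
      if "i \<in> {1..k}" "l \<in> {1..k}" "i \<noteq> l" "j \<in> {1..n}" for i j l
    proof -
      from T[OF that(1)] obtain y where "x(i := y) = level_sets n k (T i)" ..
      then have "x l = level_sets n k (T i) l" using that(3) by (metis fun_upd_other)
      then show ?thesis using mem_level_sets[OF that(2)] that(4) by simp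
    qed
    have range: "T i j \<in> {1..k}" if "i \<in> {1..k}" "j \<in> {1..n}" for i j
      using wordsD[OF subsetD[OF A TA]] that by blast
    have fixed: "T i j = l"
      if l: "l \<in> {1..k}" "j \<in> x l" and i: "i \<in> {1..k}" and j: "j \<in> {1..n}" for i j l
    proof (rule ccontr)
      assume ne: "T i j \<noteq> l"
      then have "i = l" using row l i j by blast
      then have jm: "j \<in> x (T i j)" using row[OF i range[OF i j] _ j] ne by simp
      \<comment> \<open>This is where \<open>k \<ge> 3\<close> enters: \<open>j\<close> lies in two
        parts of \<open>x\<close>, and a third row \<open>h\<close> would have to take both values
        in column \<open>j\<close>. For k = 2 the column could be (2, 1).\<close>
      have "\<not> {1..k} \<subseteq> {l, T i j}"
        using card_mono[of "{l, T i j}" "{1..k}"] ne k by auto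
      then obtain h where "h \<in> {1..k}" "h \<noteq> l" "h \<noteq> T i j" by blast
      then have "T h j = l" "T h j = T i j"
        using row l j jm range[OF i j] by blast+
      with ne show False by simp
    qed
    \<comment> \<open>An entry other than i in row i would put \<open>j\<close> into the part of
      \<open>x\<close> with that index.\<close>
    have active: "T i j = i"
      if "\<not> (\<exists>l\<in>{1..k}. j \<in> x l)" "i \<in> {1..k}" "j \<in> {1..n}" for i j
      using row[OF that(2) range[OF that(2,3)] _ that(3)] range[OF that(2,3)] that(1) by metis
    have covered: "\<exists>l\<in>{1..k}. j \<in> x l" if j: "j \<in> {1..n}" for j
    proof (rule ccontr)
      assume no: "\<not> (\<exists>l\<in>{1..k}. j \<in> x l)"
      have "combinatorial_line n k (T ` {1..k})"
        unfolding combinatorial_line_def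
      proof (intro exI[of _ T] conjI ballI)
        show "T \<in> {1..k} \<rightarrow> words n k" using TA A by blast
        \<comment> \<open>The uncovered column \<open>j\<close> displays the row index, so the rows
          are distinct.\<close>
        show "inj_on T {1..k}" using active[OF no _ j] by (metis inj_onI)
        show "(\<exists>a\<in>{1..k}. \<forall>i\<in>{1..k}. T i m = a) \<or> (\<forall>i\<in>{1..k}. T i m = i)"
          if "m \<in> {1..n}" for m
          using fixed[OF _ _ _ that] active[OF _ _ that] by blast
      qed simp
      moreover have "T ` {1..k} \<subseteq> A" using TA by blast
      ultimately show False using free unfolding line_free_def by blast
    qed
    have one: "1 \<in> {1..k}" using k by simp
    have "x = level_sets n k (T 1)"
    proof (rule PiE_ext[OF x level_sets_in_PiE])
      fix l assume l: "l \<in> {1..k}"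
      have "x l \<subseteq> {1..n}" using PiE_mem[OF x l] by blast
      then show "x l = level_sets n k (T 1) l"
        using mem_level_sets[OF l] fixed[OF _ _ one] covered l
        by (intro set_eqI) (metis subsetD)
    qed
    then show ?thesis using TA[OF one] by blast
  qed
  moreover have "level_sets n k ` A \<subseteq> {1..k} \<rightarrow>\<^sub>E Pow {1..n}" using level_sets_in_PiE by blast
  moreover have "k \<ge> 1" using k by simp
  ultimately show ?thesis by (subst cylinder_intersection_iff_star_closed) blast+
qed

text \<open>The rows of a line form a star whose centre \<open>x\<close> collects the constant
  columns by value. Closure under stars would make \<open>x\<close> a partition, although the active
  coordinates lie in none of its parts.\<close>

lemma cylinder_intersection_imp_line_free:
  assumes k: "k \<ge> 2" and A: "A \<subseteq> words n k"
    and cyl: "cylinder_intersection k (\<lambda>_. Pow {1..n}) (level_sets n k ` A)"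
  shows "line_free n k A"
  unfolding line_free_def
proof
  assume "\<exists>L. combinatorial_line n k L \<and> L \<subseteq> A"
  then obtain L where L: "combinatorial_line n k L" "L \<subseteq> A" by blast
  from L(1) obtain T where "L = T ` {1..k}" and inj: "inj_on T {1..k}"
    and cols: "\<And>j. j \<in> {1..n} \<Longrightarrow>
      (\<exists>a\<in>{1..k}. \<forall>i\<in>{1..k}. T i j = a) \<or> (\<forall>i\<in>{1..k}. T i j = i)"
    by (rule combinatorial_lineE) blast
  then have TA: "T ` {1..k} \<subseteq> A" using L(2) by simp
  have 12: "1 \<in> {1..k}" "2 \<in> {1..k}" using k by auto
  have words: "T i \<in> words n k" if "i \<in> {1..k}" for i using that TA A by blast
  \<comment> \<open>Distinctness of two rows yields an active coordinate \<open>j\<close>.\<close>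
  have "T 1 \<noteq> T 2" using inj_onD[OF inj _ 12] by auto
  then obtain j where j: "j \<in> {1..n}" "T 1 j \<noteq> T 2 j"
    using PiE_ext[OF words[OF 12(1), unfolded words_def] words[OF 12(2), unfolded words_def]]
    by blast
  define x where "x = (\<lambda>l\<in>{1..k}. {j \<in> {1..n}. \<forall>i\<in>{1..k}. T i j = l})"
  have x: "x \<in> {1..k} \<rightarrow>\<^sub>E Pow {1..n}" by (auto simp: x_def)
  have "x(i := level_sets n k (T i) i) = level_sets n k (T i)" if i: "i \<in> {1..k}" for i
  proof
    fix l
    \<comment> \<open>An entry \<open>l\<close> in row \<open>i\<close> with
      \<open>l \<noteq> i\<close> excludes the column (1, ..., k), so the column is
      constant.\<close>
    have "(\<forall>h\<in>{1..k}. T h m = l) \<longleftrightarrow> T i m = l" if "l \<noteq> i" "m \<in> {1..n}" for m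
      using cols[OF that(2)] i that(1) by metis
    then have "{m \<in> {1..n}. \<forall>h\<in>{1..k}. T h m = l} = {m \<in> {1..n}. T i m = l}" if "l \<noteq> i"
      using that by blast
    then show "(x(i := level_sets n k (T i) i)) l = level_sets n k (T i) l"
      by (simp add: x_def level_sets_def)
  qed
  moreover have "level_sets n k (T i) i \<in> Pow {1..n}" if "i \<in> {1..k}" for i
    using that by (auto simp: level_sets_def)
  ultimately have "\<forall>i\<in>{1..k}. \<exists>y\<in>Pow {1..n}. x(i := y) \<in> level_sets n k ` A"
    using TA by (metis imageI subsetD)
  moreover have "k \<ge> 1" using k by simp
  ultimately have "x \<in> level_sets n k ` A"
    using cyl[unfolded cylinder_intersection_iff_star_closed[OF \<open>k \<ge> 1\<close>]] x by blast
  then obtain w where "w \<in> words n k" "x = level_sets n k w" using A by blast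
  then have "w j \<in> {1..k}" "j \<in> x (w j)" using j(1) wordsD mem_level_sets by blast+
  then have "\<forall>i\<in>{1..k}. T i j = w j" by (simp add: x_def)
  then show False using j(2) 12 by simp
qed

lemma line_free_iff_cylinder_intersection:
  assumes "k \<ge> 3" and "A \<subseteq> words n k"
  shows "line_free n k A \<longleftrightarrow>
    cylinder_intersection k (\<lambda>_. Pow {1..n}) (level_sets n k ` A)"
proof
  show "line_free n k A" if "cylinder_intersection k (\<lambda>_. Pow {1..n}) (level_sets n k ` A)"
    using cylinder_intersection_imp_line_free[OF _ assms(2) that] assms(1) by simp
qed (rule line_free_imp_cylinder_intersection[OF assms])

section \<open>Equality of the two maxima\<close>

text \<open>Taking images under the injective map \<open>level_sets n k\<close> preserves
  cardinality and matches the two families of sets, so both \<open>Max\<close> range over the same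
  set of numbers.\<close>

lemma density_hales_jewett_eq_nof_alpha:
  assumes k: "k \<ge> 3"
  shows "density_hales_jewett n k = nof_alpha k (\<lambda>_. Pow {1..n}) (Part n k)"
proof -
  let ?O = "ones k (\<lambda>_. Pow {1..n}) (Part n k)" and ?F = "level_sets n k"
  let ?cyl = "cylinder_intersection k (\<lambda>_. Pow {1..n})"
  have inj: "inj_on ?F (words n k)" and img: "?F ` words n k = ?O"
    using bij_betw_level_sets unfolding bij_betw_def by blast+
  have "{card A | A. A \<subseteq> words n k \<and> line_free n k A} = {card C | C. ?cyl C \<and> C \<subseteq> ?O}"
  proof (intro set_eqI iffI)
    fix m assume "m \<in> {card A | A. A \<subseteq> words n k \<and> line_free n k A}"
    then obtain A where A: "m = card A" "A \<subseteq> words n k" "line_free n k A" by blast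
    then have "m = card (?F ` A)" using card_image[OF inj_on_subset[OF inj]] by simp
    moreover have "?cyl (?F ` A)" using line_free_iff_cylinder_intersection[OF k] A by blast
    moreover have "?F ` A \<subseteq> ?O" using A(2) img by blast
    ultimately show "m \<in> {card C | C. ?cyl C \<and> C \<subseteq> ?O}" by blast
  next
    fix m assume "m \<in> {card C | C. ?cyl C \<and> C \<subseteq> ?O}"
    then obtain C where C: "m = card C" "?cyl C" "C \<subseteq> ?F ` words n k" unfolding img by blast
    then obtain A where A: "A \<subseteq> words n k" "C = ?F ` A" by (meson subset_imageE)
    then have "m = card A" using C(1) card_image[OF inj_on_subset[OF inj]] by simp
    moreover have "line_free n k A" using line_free_iff_cylinder_intersection[OF k] A C(2) by blast
    ultimately show "m \<in> {card A | A. A \<subseteq> words n k \<and> line_free n k A}" using A(1) by blast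
  qed
  then show ?thesis by (simp add: density_hales_jewett_def nof_alpha_def line_free_def)
qed

section \<open>Colourings and partitions into cylinder intersections\<close>

lemma line_free_subset: "line_free n k B \<Longrightarrow> A \<subseteq> B \<Longrightarrow> line_free n k A"
  unfolding line_free_def by blast

lemma combinatorial_line_subset_words: "combinatorial_line n k L \<Longrightarrow> L \<subseteq> words n k"
  unfolding combinatorial_line_def by blast

text \<open>Serves to make empty colour classes line-free.\<close>

lemma combinatorial_line_nonempty: "k \<ge> 1 \<Longrightarrow> combinatorial_line n k L \<Longrightarrow> L \<noteq> {}"
  by (erule combinatorial_lineE) auto

text \<open>A line consists of words, so it has the single colour \<open>a\<close> exactly when it
  is contained in the colour class of \<open>a\<close>.\<close>

lemma no_monochromatic_line_iff:
  "\<not> (\<exists>L. combinatorial_line n k L \<and> (\<exists>a. \<forall>w\<in>L. c w = a)) \<longleftrightarrow>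
     (\<forall>a. line_free n k {w \<in> words n k. c w = a})"
proof -
  have "L \<subseteq> {w \<in> words n k. c w = a} \<longleftrightarrow> (\<forall>w\<in>L. c w = a)" if "combinatorial_line n k L" for L a
    using combinatorial_line_subset_words[OF that] by auto
  then show ?thesis unfolding line_free_def by metis
qed

text \<open>Each word gets the number of the block containing its tuple of level sets; a colour
  class then lies in the preimage of one cylinder intersection.\<close>

lemma coloring_of_partition:
  assumes k: "k \<ge> 3" and P: "partition_on (ones k (\<lambda>_. Pow {1..n}) (Part n k)) P" "finite P"
    and cyl: "\<forall>C\<in>P. cylinder_intersection k (\<lambda>_. Pow {1..n}) C"
  shows "\<exists>c :: (nat \<Rightarrow> nat) \<Rightarrow> nat. c \<in> words n k \<rightarrow> {1..card P} \<and>
    (\<forall>a. line_free n k {w \<in> words n k. c w = a})"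
proof -
  let ?F = "level_sets n k"
  have img: "?F ` words n k = \<Union>P"
    using bij_betw_level_sets partition_onD1[OF P(1)] unfolding bij_betw_def by blast
  obtain h where h: "bij_betw h P {1..card P}"
    using finite_same_card_bij[OF P(2), of "{1..card P}"] by auto
  have "\<forall>w\<in>words n k. \<exists>C. C \<in> P \<and> ?F w \<in> C" using img by blast
  then obtain cls where cls: "\<And>w. w \<in> words n k \<Longrightarrow> cls w \<in> P \<and> ?F w \<in> cls w" by metis
  have "line_free n k {w \<in> words n k. h (cls w) = a}" (is "line_free n k ?A") for a
  proof (cases "?A = {}")
    \<comment> \<open>The colour \<open>a\<close> is arbitrary and may be the number of no
      block.\<close>
    case True
    have "k \<ge> 1" using k by simp
    then show ?thesis
      unfolding True line_free_def using combinatorial_line_nonempty by blast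
  next
    case False
    then obtain v where v: "v \<in> words n k" "h (cls v) = a" by blast
    let ?B = "{w \<in> words n k. ?F w \<in> cls v}"
    have "cls v \<subseteq> ?F ` words n k" unfolding img using cls[OF v(1)] by (simp add: Union_upper)
    then have "?F ` ?B = cls v" by auto
    then have "line_free n k ?B"
      using line_free_iff_cylinder_intersection[OF k, of ?B n] cyl cls[OF v(1)] by auto
    moreover have "?A \<subseteq> ?B"
      using cls v inj_onD[OF bij_betw_imp_inj_on[OF h]] by fastforce
    ultimately show ?thesis by (rule line_free_subset)
  qed
  moreover have "(\<lambda>w. h (cls w)) \<in> words n k \<rightarrow> {1..card P}"
    using cls bij_betw_apply[OF h] by blast
  ultimately show ?thesis by blast
qed

text \<open>The blocks are the images of the colour classes. Blocks are nonempty, so colours that do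
  not occur are dropped and only \<open>card P \<le> m\<close> results.\<close>

lemma partition_of_coloring:
  fixes c :: "(nat \<Rightarrow> nat) \<Rightarrow> nat"
  assumes k: "k \<ge> 3" and c: "c \<in> words n k \<rightarrow> {1..m}"
    and free: "\<And>a. line_free n k {w \<in> words n k. c w = a}"
  shows "\<exists>P. partition_on (ones k (\<lambda>_. Pow {1..n}) (Part n k)) P \<and> finite P \<and> card P \<le> m \<and>
    (\<forall>C\<in>P. cylinder_intersection k (\<lambda>_. Pow {1..n}) C)"
proof -
  let ?F = "level_sets n k"
  define cls where "cls a = ?F ` {w \<in> words n k. c w = a}" for a
  let ?P = "cls ` c ` words n k"
  have inj: "inj_on ?F (words n k)"
    and img: "?F ` words n k = ones k (\<lambda>_. Pow {1..n}) (Part n k)"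
    using bij_betw_level_sets unfolding bij_betw_def by blast+
  have "partition_on (?F ` words n k) ?P"
  proof (rule partition_onI)
    show "\<Union>?P = ?F ` words n k" by (auto simp: cls_def)
    show "disjnt p q" if "p \<in> ?P" "q \<in> ?P" "p \<noteq> q" for p q
    proof -
      obtain a b where ab: "p = cls a" "q = cls b" using \<open>p \<in> ?P\<close> \<open>q \<in> ?P\<close> by blast
      then have "{w \<in> words n k. c w = a} \<inter> {w \<in> words n k. c w = b} = {}"
        using \<open>p \<noteq> q\<close> by auto
      then show ?thesis
        unfolding ab cls_def disjnt_def
        by (subst inj_on_image_Int[OF inj, symmetric]) auto
    qed
  qed (auto simp: cls_def)
  moreover have "card ?P \<le> card (c ` words n k)" "finite ?P"
    using finite_words by (auto intro: card_image_le)
  moreover have "card (c ` words n k) \<le> m" using card_mono[of "{1..m}" "c ` words n k"] c by (simp add: image_subset_iff_funcset)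
  moreover have "\<forall>C\<in>?P. cylinder_intersection k (\<lambda>_. Pow {1..n}) C"
    unfolding cls_def using line_free_imp_cylinder_intersection[OF k _ free] by auto
  ultimately show ?thesis unfolding img by (meson le_trans)
qed

text \<open>Giving all words different colours works, because a line contains two different words.
  This ensures that the \<open>LEAST\<close> in \<open>line_coloring_number\<close> is
  attained.\<close>

lemma exists_line_free_coloring:
  assumes "k \<ge> 2"
  shows "\<exists>m. \<exists>c :: (nat \<Rightarrow> nat) \<Rightarrow> nat. c \<in> words n k \<rightarrow> {1..m} \<and>
    (\<forall>a. line_free n k {w \<in> words n k. c w = a})"
proof -
  obtain h where h: "bij_betw h (words n k) {1..card (words n k)}"
    using finite_same_card_bij[OF finite_words, of "{1..card (words n k)}"] by auto
  have "line_free n k {w \<in> words n k. h w = a}" for a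
    unfolding line_free_def
  proof
    assume "\<exists>L. combinatorial_line n k L \<and> L \<subseteq> {w \<in> words n k. h w = a}"
    then obtain T where T: "inj_on T {1..k}" "T ` {1..k} \<subseteq> {w \<in> words n k. h w = a}"
      unfolding combinatorial_line_def by blast
    have 12: "1 \<in> {1..k}" "2 \<in> {1..k}" using assms by auto
    then have "T 1 = T 2"
      using T(2) inj_onD[OF bij_betw_imp_inj_on[OF h], of "T 1" "T 2"] by blast
    then show False using inj_onD[OF T(1) _ 12] by simp
  qed
  then show ?thesis using bij_betw_imp_funcset[OF h] by blast
qed

text \<open>\<open>p m\<close> asks for exactly \<open>m\<close> blocks, while \<open>q m\<close>
  allows at most \<open>m\<close> colours. Hence \<open>q m\<close> only gives \<open>p m'\<close>
  for some \<open>m' \<le> m\<close>, which together with \<open>p m\<close> implying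
  \<open>q m\<close> still makes the least values agree.\<close>

lemma nof_chi_eq_line_coloring_number:
  assumes k: "k \<ge> 3"
  shows "nof_chi k (\<lambda>_. Pow {1..n}) (Part n k) = line_coloring_number n k"
proof -
  define p where "p m \<longleftrightarrow> (\<exists>P. partition_on (ones k (\<lambda>_. Pow {1..n}) (Part n k)) P \<and> finite P \<and>
    card P = m \<and> (\<forall>C\<in>P. cylinder_intersection k (\<lambda>_. Pow {1..n}) C))" for m
  define q where "q m \<longleftrightarrow> (\<exists>c :: (nat \<Rightarrow> nat) \<Rightarrow> nat. c \<in> words n k \<rightarrow> {1..m} \<and>
    (\<forall>a. line_free n k {w \<in> words n k. c w = a}))" for m
  have pq: "q m" if "p m" for m
    using that coloring_of_partition[OF k] unfolding p_def q_def by blast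
  have qp: "\<exists>m'\<le>m. p m'" if "q m" for m
    using that partition_of_coloring[OF k, of _ n m] unfolding p_def q_def by blast
  have "\<exists>m. q m" using exists_line_free_coloring[of k n] k unfolding q_def by simp
  then have q: "q (Least q)" by (rule LeastI_ex)
  then obtain m where m: "m \<le> Least q" "p m" using qp by blast
  have "Least p \<le> m" using m(2) by (rule Least_le)
  moreover have "Least q \<le> Least p" using pq[OF LeastI[of p, OF m(2)]] by (rule Least_le)
  ultimately have "Least p = Least q" using m(1) by simp
  moreover have "nof_chi k (\<lambda>_. Pow {1..n}) (Part n k) = Least p"
    unfolding nof_chi_def p_def ..
  moreover have "line_coloring_number n k = Least q"
    unfolding line_coloring_number_def no_monochromatic_line_iff q_def ..
  ultimately show ?thesis by simp
qed

theorem theorem4: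
  fixes k n :: nat
  assumes "k \<ge> 3" and "n \<ge> 1"
  shows "density_hales_jewett n k = nof_alpha k (\<lambda>_. Pow {1..n}) (Part n k) \<and>
         nof_chi k (\<lambda>_. Pow {1..n}) (Part n k) = line_coloring_number n k"
  using density_hales_jewett_eq_nof_alpha nof_chi_eq_line_coloring_number assms by blast

end
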